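(* For a given graph $F$, we have $\mathrm{rex}(n,F)=0$ for infinitely many $n$ if and only if every component of $F$ is $P_2$ or $P_3$, except for at most one component that is $P_4$.
   Context: $\mathrm{rex}(n,F)$ denotes the maximum number of edges that a regular graph on $n$ vertices can have without containing a copy of $F$ as a (not necessarily induced) subgraph; the edgeless graph counts as regular (of degree $0$). $P_k$ denotes the path on $k$ vertices. All graphs are finite and simple.
   Formalization: F is assumed nonempty and without isolated vertices: for F = P_2 plus an isolated vertex, rex(n,F)=0 for all n ≥ 3 though one component is P_1, so the literal claim fails; for edgeless F, rex(n,F) is undefined for large n. *)

theory Defs
  imports "Graph_Theory.Graph_Theory"
begin

text \<open>
  Finite simple graphs are the symmetric, loop-free \<^emph>\<open>pair graphs\<close> of the library
  (\<^locale>\<open>pair_graph\<close>): every undirected edge is represented by its two arcs.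
\<close>

definition num_edges :: "'a pair_pre_digraph \<Rightarrow> nat" where
  "num_edges G = card ((\<lambda>(u, v). {u, v}) ` parcs G)"

text \<open>In a symmetric digraph the out-degree of a vertex is its number of neighbours.\<close>

definition regular_graph :: "'a pair_pre_digraph \<Rightarrow> bool" where
  "regular_graph G \<longleftrightarrow> (\<exists>d. \<forall>v \<in> pverts G. out_degree (with_proj G) v = d)"

definition contains_copy :: "'a pair_pre_digraph \<Rightarrow> 'b pair_pre_digraph \<Rightarrow> bool" where
  "contains_copy G F \<longleftrightarrow>
     (\<exists>H :: 'a pair_pre_digraph.
        subgraph (with_proj H) (with_proj G) \<and> digraph_iso (with_proj F) (with_proj H))"

text \<open>
  Every finite graph is isomorphic to one with vertices in \<^typ>\<open>nat\<close>, so host graphs are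
  taken there. If \<open>F\<close> has an edge, the edgeless graph on \<open>n\<close> vertices is \<open>F\<close>-free, so the
  maximum is over a finite nonempty set; if \<open>F\<close> is edgeless, that set may be empty
  (namely when \<open>F\<close> has at most \<open>n\<close> vertices), and then the value is unspecified.
\<close>

definition rex :: "nat \<Rightarrow> 'a pair_pre_digraph \<Rightarrow> nat" where
  "rex n F = Max {num_edges G | G :: nat pair_pre_digraph.
     pair_graph G \<and> card (pverts G) = n \<and> regular_graph G \<and> \<not> contains_copy G F}"

definition path_graph :: "nat \<Rightarrow> nat pair_pre_digraph" where
  "path_graph k =
     \<lparr>pverts = {..<k}, parcs = {(i, j). i < k \<and> j < k \<and> (j = Suc i \<or> i = Suc j)}\<rparr>"

definition is_path :: "nat \<Rightarrow> ('a, 'b) pre_digraph \<Rightarrow> bool" where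
  "is_path k C \<longleftrightarrow> digraph_iso C (with_proj (path_graph k))"

text \<open>Strong connectivity in a symmetric digraph is connectivity of the undirected graph.\<close>

definition components :: "'a pair_pre_digraph \<Rightarrow> ('a, 'a \<times> 'a) pre_digraph set" where
  "components F = pre_digraph.sccs (with_proj F)"

definition no_isolated_verts :: "'a pair_pre_digraph \<Rightarrow> bool" where
  "no_isolated_verts F \<longleftrightarrow> (\<forall>v \<in> pverts F. out_degree (with_proj F) v \<noteq> 0)"

end

theory Submission
  imports Defs
begin

text \<open>
  If \<open>F\<close> has a component that is not \<open>P\<^sub>2\<close>, \<open>P\<^sub>3\<close> or \<open>P\<^sub>4\<close>, or two components \<open>P\<^sub>4\<close>, then every
  large \<open>n\<close> admits an \<open>F\<close>-free 2-regular graph: a union of triangles and 4-cycles has no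
  component with at least 5 vertices; in the single cycle \<open>C\<^sub>n\<close> every connected subgraph with
  fewer than \<open>n\<close> vertices is a path; and a union of triangles and one cycle of length at most 5 has
  no room for two disjoint \<open>P\<^sub>4\<close>.

  Conversely let \<open>n \<equiv> 1 (mod 6)\<close> be large. A regular graph on \<open>n\<close> vertices with an edge has even
  degree \<open>d \<ge> 2\<close>. It contains a \<open>P\<^sub>4\<close>, being otherwise a disjoint union of triangles. For every
  small vertex set \<open>S\<close> it contains a \<open>P\<^sub>3\<close> avoiding \<open>S\<close>: if \<open>d\<close> is large, every vertex outside \<open>S\<close>
  has two neighbours outside \<open>S\<close>, and if \<open>d\<close> is small, some vertex is outside the closed
  neighbourhood of \<open>S\<close>. So the components of \<open>F\<close> can be embedded greedily.
\<close>

section \<open>Embeddings\<close>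

text \<open>The working form of a not necessarily induced copy;
  \<open>contains_copy_iff_embedding\<close> links it to subgraphs and isomorphisms.\<close>

definition embedding :: "('a \<Rightarrow> 'b) \<Rightarrow> 'a pair_pre_digraph \<Rightarrow> 'b pair_pre_digraph \<Rightarrow> bool" where
  "embedding \<phi> F G \<longleftrightarrow> inj_on \<phi> (pverts F) \<and> \<phi> ` pverts F \<subseteq> pverts G \<and>
     (\<forall>u v. (u, v) \<in> parcs F \<longrightarrow> (\<phi> u, \<phi> v) \<in> parcs G)"

text \<open>The vertex set is \<open>S\<close> itself rather than its intersection with
  \<open>pverts F\<close>, so the result is well-formed for arbitrary \<open>F\<close> and
  \<open>S\<close>.\<close>

definition induced :: "'a pair_pre_digraph \<Rightarrow> 'a set \<Rightarrow> 'a pair_pre_digraph" where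
  "induced F S = \<lparr>pverts = S, parcs = {(u, v). (u, v) \<in> parcs F \<and> u \<in> S \<and> v \<in> S}\<rparr>"

lemma induced_simps [simp]:
  "pverts (induced F S) = S"
  "(u, v) \<in> parcs (induced F S) \<longleftrightarrow> (u, v) \<in> parcs F \<and> u \<in> S \<and> v \<in> S"
  by (auto simp: induced_def)

lemma pair_wf_digraph_induced: "pair_wf_digraph (induced F S)"
  by unfold_locales auto

lemma (in pair_sym_digraph) pair_sym_digraph_induced: "pair_sym_digraph (induced G S)"
proof -
  interpret I: pair_wf_digraph "induced G S" by (rule pair_wf_digraph_induced)
  have "sym (parcs (induced G S))"
    by (rule symI) (simp add: arcs_symmetric)
  then show ?thesis by unfold_locales (simp add: symmetric_def)
qed

lemma embedding_inj_on: "embedding \<phi> F G \<Longrightarrow> S \<subseteq> pverts F \<Longrightarrow> inj_on \<phi> S"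
  unfolding embedding_def by (elim conjE, rule inj_on_subset)

lemma embedding_trans:
  assumes "embedding \<phi> A B" "embedding \<psi> B C"
  shows "embedding (\<psi> \<circ> \<phi>) A C"
proof -
  have "inj_on (\<psi> \<circ> \<phi>) (pverts A)"
    using assms inj_on_subset[of \<psi> "pverts B" "\<phi> ` pverts A"]
    by (intro comp_inj_on) (simp_all add: embedding_def)
  moreover have "(\<psi> \<circ> \<phi>) ` pverts A \<subseteq> pverts C"
    using assms by (force simp: embedding_def)
  ultimately show ?thesis using assms by (simp add: embedding_def)
qed

text \<open>An arc of a pair graph is determined by its ends, so the arc map of an isomorphism is
  forced by the vertex map, and only the latter has to be given.\<close>

lemma digraph_iso_with_proj_iff:
  fixes A :: "'a pair_pre_digraph" and B :: "'b pair_pre_digraph"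
  assumes "pair_wf_digraph A"
  shows "digraph_iso (with_proj A) (with_proj B) \<longleftrightarrow>
    (\<exists>\<phi>. inj_on \<phi> (pverts A) \<and> pverts B = \<phi> ` pverts A \<and> parcs B = map_prod \<phi> \<phi> ` parcs A)"
    (is "_ \<longleftrightarrow> (\<exists>\<phi>. ?iso \<phi>)")
proof
  interpret A: pair_wf_digraph A by fact
  assume "digraph_iso (with_proj A) (with_proj B)"
  then obtain f where f: "A.digraph_isomorphism f" and B: "with_proj B = app_iso f (with_proj A)"
    by (auto simp: digraph_iso_def)
  \<comment> \<open>Comparing the \<open>tail\<close> and \<open>head\<close> fields forces the end
    maps of \<open>f\<close> to be the projections.\<close>
  have "pverts B = iso_verts f ` pverts A" "parcs B = iso_arcs f ` parcs A"
    "iso_tail f = fst" "iso_head f = snd"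
    using arg_cong[OF B, of verts] arg_cong[OF B, of arcs]
      arg_cong[OF B, of tail] arg_cong[OF B, of head] by auto
  moreover from this f have "iso_arcs f a = map_prod (iso_verts f) (iso_verts f) a"
    if "a \<in> parcs A" for a
    using that unfolding A.digraph_isomorphism_def
    by (cases a) (auto simp: prod_eq_iff)
  then have "iso_arcs f ` parcs A = map_prod (iso_verts f) (iso_verts f) ` parcs A"
    by (rule image_cong[OF refl])
  ultimately have "?iso (iso_verts f)"
    using f by (simp add: A.digraph_isomorphism_def)
  then show "\<exists>\<phi>. ?iso \<phi>" by (rule exI[of _ "iso_verts f"])
next
  interpret A: pair_wf_digraph A by fact
  assume "\<exists>\<phi>. ?iso \<phi>"
  then obtain \<phi> where \<phi>: "?iso \<phi>" ..
  let ?f = "\<lparr>iso_verts = \<phi>, iso_arcs = map_prod \<phi> \<phi>, iso_head = snd, iso_tail = fst\<rparr>"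
  have "inj_on (map_prod \<phi> \<phi>) (parcs A)"
    using \<phi> map_prod_inj_on[of \<phi> "pverts A" \<phi> "pverts A"]
    by (rule_tac inj_on_subset[of _ "pverts A \<times> pverts A"]) (auto dest: A.wellformed')
  then have "A.digraph_isomorphism ?f"
    using \<phi> A.wf_digraph_axioms by (auto simp: A.digraph_isomorphism_def)
  moreover have "with_proj B = app_iso ?f (with_proj A)"
    using \<phi> by (auto simp: app_iso_def with_proj_def)
  ultimately show "digraph_iso (with_proj A) (with_proj B)"
    unfolding digraph_iso_def by blast
qed

lemma contains_copy_iff_embedding:
  fixes F :: "'a pair_pre_digraph" and G :: "'b pair_pre_digraph"
  assumes F: "pair_wf_digraph F" and G: "pair_wf_digraph G"
  shows "contains_copy G F \<longleftrightarrow> (\<exists>\<phi>. embedding \<phi> F G)"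
proof
  assume "contains_copy G F"
  then obtain H :: "'b pair_pre_digraph" where
    "subgraph (with_proj H) (with_proj G)" "digraph_iso (with_proj F) (with_proj H)"
    by (auto simp: contains_copy_def)
  then have "pverts H \<subseteq> pverts G" "parcs H \<subseteq> parcs G"
    by (auto simp: subgraph_def)
  moreover obtain \<phi> where "inj_on \<phi> (pverts F)" "pverts H = \<phi> ` pverts F"
    "parcs H = map_prod \<phi> \<phi> ` parcs F"
    using \<open>digraph_iso (with_proj F) (with_proj H)\<close>
    unfolding digraph_iso_with_proj_iff[OF F] by blast
  ultimately have "embedding \<phi> F G"
    unfolding embedding_def by force
  then show "\<exists>\<phi>. embedding \<phi> F G" by blast
next
  assume "\<exists>\<phi>. embedding \<phi> F G"
  then obtain \<phi> where \<phi>: "embedding \<phi> F G" ..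
  let ?H = "\<lparr>pverts = \<phi> ` pverts F, parcs = map_prod \<phi> \<phi> ` parcs F\<rparr>"
  interpret F: pair_wf_digraph F by fact
  have H: "pair_wf_digraph ?H"
    by unfold_locales (auto dest: F.wellformed')
  have "subgraph (with_proj ?H) (with_proj G)"
  proof (rule subgraphI)
    show "arcs (with_proj ?H) \<subseteq> arcs (with_proj G)"
      using \<phi> by (auto simp: embedding_def)
  qed (use \<phi> F G H in \<open>simp_all add: wf_digraph_wp_iff compatible_def embedding_def\<close>)
  moreover have "digraph_iso (with_proj F) (with_proj ?H)"
    unfolding digraph_iso_with_proj_iff[OF F]
    by (rule exI[of _ \<phi>]) (use \<phi> in \<open>simp add: embedding_def\<close>)
  ultimately show "contains_copy G F"
    unfolding contains_copy_def by blast
qed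

section \<open>Components\<close>

text \<open>Only forward reachability is used; on symmetric arcs these sets are the classes of an
  equivalence relation, see \<open>component_eq\<close>.\<close>

definition component :: "'a pair_pre_digraph \<Rightarrow> 'a \<Rightarrow> 'a set" where
  "component F u = (parcs F)\<^sup>* `` {u}"

lemma component_refl: "u \<in> component F u"
  by (simp add: component_def)

lemma component_closed: "(x, y) \<in> parcs F \<Longrightarrow> x \<in> component F u \<Longrightarrow> y \<in> component F u"
  by (auto simp: component_def intro: rtrancl_into_rtrancl)

text \<open>Induction along a walk from \<open>u\<close>. Closure of \<open>T\<close> is asked only
  at vertices of the component, so closure under the arcs of the induced graph is enough
  later.\<close>

lemma component_least:
  assumes "u \<in> T" and "\<And>x y. (x, y) \<in> parcs F \<Longrightarrow> x \<in> component F u \<Longrightarrow> x \<in> T \<Longrightarrow> y \<in> T"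
  shows "component F u \<subseteq> T"
proof
  fix v assume "v \<in> component F u"
  then have "(u, v) \<in> (parcs F)\<^sup>*" by (simp add: component_def)
  then have "v \<in> T \<and> v \<in> component F u"
    by induction (use assms component_closed component_refl in \<open>fastforce+\<close>)
  then show "v \<in> T" ..
qed

lemma (in pair_wf_digraph) component_subset:
  assumes "u \<in> pverts G" shows "component G u \<subseteq> pverts G"
  by (rule component_least) (use assms in \<open>auto dest: wellformed'\<close>)

lemma (in pair_sym_digraph) component_eq:
  assumes "v \<in> component G u" shows "component G v = component G u"
proof -
  have "(u, v) \<in> (parcs G)\<^sup>*" using assms by (simp add: component_def)
  moreover have "sym ((parcs G)\<^sup>*)"
    by (rule sym_rtrancl) (auto intro: symI arcs_symmetric)
  ultimately show ?thesis
    unfolding component_def by (auto dest: symD intro: rtrancl_trans)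
qed

lemma (in pair_wf_digraph) reachable_iff_rtrancl:
  "u \<rightarrow>\<^sup>*\<^bsub>with_proj G\<^esub> v \<longleftrightarrow> u \<in> pverts G \<and> (u, v) \<in> (parcs G)\<^sup>*"
proof
  assume "u \<rightarrow>\<^sup>*\<^bsub>with_proj G\<^esub> v"
  then show "u \<in> pverts G \<and> (u, v) \<in> (parcs G)\<^sup>*"
    by (induction rule: reachable_induct) (auto intro: rtrancl_into_rtrancl)
next
  assume *: "u \<in> pverts G \<and> (u, v) \<in> (parcs G)\<^sup>*"
  then have "(u, v) \<in> (parcs G)\<^sup>*" ..
  then show "u \<rightarrow>\<^sup>*\<^bsub>with_proj G\<^esub> v"
    by induction (use * in \<open>auto intro: reachable_adj_trans\<close>)
qed

text \<open>Symmetry lets every walk be reversed, so the strong component of \<open>u\<close> is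
  just what \<open>u\<close> reaches.\<close>

lemma (in pair_sym_digraph) components_conv_component:
  "components G = (\<lambda>u. with_proj (induced G (component G u))) ` pverts G"
proof -
  have "scc_of u = component G u" if "u \<in> pverts G" for u
  proof -
    have "v \<rightarrow>\<^sup>*\<^bsub>with_proj G\<^esub> u" if "u \<rightarrow>\<^sup>*\<^bsub>with_proj G\<^esub> v" for v
      using that symmetric_reachable[OF sym_arcs] by blast
    then show ?thesis
      using that by (auto simp: scc_of_def component_def reachable_iff_rtrancl)
  qed
  moreover have "induce_subgraph (with_proj G) S = with_proj (induced G S)" for S
    by (auto simp: induce_subgraph_def with_proj_def induced_def)
  ultimately show ?thesis
    unfolding components_def sccs_conv_sccs_verts sccs_verts_conv_scc_of
    by (auto simp: image_image)
qed

section \<open>Paths\<close>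

lemma path_graph_simps [simp]:
  "pverts (path_graph k) = {..<k}"
  "(i, j) \<in> parcs (path_graph k) \<longleftrightarrow> i < k \<and> j < k \<and> (j = Suc i \<or> i = Suc j)"
  by (auto simp: path_graph_def)

lemma is_pathD:
  assumes "is_path k (with_proj A)" "pair_wf_digraph A"
  obtains \<phi> where "embedding \<phi> A (path_graph k)" "card (pverts A) = k"
proof -
  obtain \<phi> where \<phi>: "inj_on \<phi> (pverts A)" "pverts (path_graph k) = \<phi> ` pverts A"
    "parcs (path_graph k) = map_prod \<phi> \<phi> ` parcs A"
    using assms(1) unfolding is_path_def digraph_iso_with_proj_iff[OF assms(2)] by blast
  then have "embedding \<phi> A (path_graph k)" unfolding embedding_def by force
  moreover have "card (pverts A) = k"
    using card_image[OF \<phi>(1)] \<phi>(2)[symmetric] by simp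
  ultimately show thesis by (rule that)
qed

text \<open>A connected graph placed injectively on the integers with all edges of length 1 fills an
  interval and uses every unit step in it. Connectivity enters as \<open>conn\<close>: a set closed
  under arcs that meets the graph contains all of it.\<close>

lemma is_pathI_integer_embedding:
  fixes \<psi> :: "'a \<Rightarrow> nat"
  assumes A: "pair_sym_digraph A" and fin: "finite (pverts A)" and ne: "pverts A \<noteq> {}"
    and conn: "\<And>T x. x \<in> pverts A \<Longrightarrow> x \<in> T \<Longrightarrow> (\<And>a b. (a, b) \<in> parcs A \<Longrightarrow> a \<in> T \<Longrightarrow> b \<in> T)
      \<Longrightarrow> pverts A \<subseteq> T"
    and inj: "inj_on \<psi> (pverts A)"
    and step: "\<And>a b. (a, b) \<in> parcs A \<Longrightarrow> \<psi> b = Suc (\<psi> a) \<or> \<psi> a = Suc (\<psi> b)"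
  shows "is_path (card (pverts A)) (with_proj A)"
proof -
  interpret A: pair_sym_digraph A by fact
  let ?I = "\<psi> ` pverts A"
  define m where "m = Min ?I"
  define M where "M = Max ?I"
  have mM: "m \<in> ?I" "M \<in> ?I" "\<And>x. x \<in> pverts A \<Longrightarrow> m \<le> \<psi> x \<and> \<psi> x \<le> M"
    using fin ne by (auto simp: m_def M_def intro!: Min_in Max_in)
  \<comment> \<open>If no edge crossed from \<open>t\<close> to \<open>Suc t\<close>, the vertices
    of value at most \<open>t\<close> would be closed under arcs; they include the minimum, so by
    connectivity also the maximum.\<close>
  have arc: "\<exists>a b. (a, b) \<in> parcs A \<and> \<psi> a = t \<and> \<psi> b = Suc t" if t: "m \<le> t" "t < M" for t
  proof (rule ccontr)
    assume none: "\<not> ?thesis"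
    obtain x where x: "x \<in> pverts A" "\<psi> x = m" using mM by auto
    have "pverts A \<subseteq> {v. \<psi> v \<le> t}"
    proof (rule conn[OF x(1)])
      show "x \<in> {v. \<psi> v \<le> t}" using x t by simp
      fix a b assume "(a, b) \<in> parcs A" "a \<in> {v. \<psi> v \<le> t}"
      then show "b \<in> {v. \<psi> v \<le> t}"
        using none step[of a b] by (cases "\<psi> a = t") auto
    qed
    then show False using mM(2) t by auto
  qed
  have I: "?I = {m..M}"
  proof (rule antisym)
    show "?I \<subseteq> {m..M}" using mM(3) by auto
    show "{m..M} \<subseteq> ?I"
    proof
      fix t assume "t \<in> {m..M}"
      then show "t \<in> ?I"
        using arc[of t] mM(2) A.in_arcsD1 by (cases "t = M") fastforce+
    qed
  qed
  define k where "k = card (pverts A)"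
  have k: "k = Suc M - m"
    using card_image[OF inj] I by (simp add: k_def)
  have "m \<le> M" using mM by auto
  \<comment> \<open>Shifting by the minimum moves the interval to the vertex set of
    \<open>path_graph k\<close>.\<close>
  define \<phi> where "\<phi> x = \<psi> x - m" for x
  have \<phi>m: "\<phi> x + m = \<psi> x" if "x \<in> pverts A" for x
    using mM(3)[OF that] by (simp add: \<phi>_def)
  have inj': "inj_on \<phi> (pverts A)"
    by (rule inj_onI) (metis \<phi>m inj inj_onD)
  have im: "{..<k} = \<phi> ` pverts A"
  proof -
    have "\<phi> ` pverts A = (\<lambda>t. t - m) ` {m..M}"
      unfolding I[symmetric] image_image \<phi>_def ..
    also have "\<dots> = {..<k}"
    proof
      show "{..<k} \<subseteq> (\<lambda>t. t - m) ` {m..M}"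
      proof
        fix i assume "i \<in> {..<k}"
        then show "i \<in> (\<lambda>t. t - m) ` {m..M}"
          using k by (intro image_eqI[of _ _ "i + m"]) auto
      qed
    qed (use k in auto)
    finally show ?thesis by simp
  qed
  have up: "(i, Suc i) \<in> map_prod \<phi> \<phi> ` parcs A \<and> (Suc i, i) \<in> map_prod \<phi> \<phi> ` parcs A"
    if "Suc i < k" for i
  proof -
    have "m \<le> i + m" "i + m < M" using that k by auto
    then obtain a b where ab: "(a, b) \<in> parcs A" "\<psi> a = i + m" "\<psi> b = Suc (i + m)"
      using arc by blast
    then have "\<phi> a = i" "\<phi> b = Suc i" by (auto simp: \<phi>_def)
    then show ?thesis
      using ab(1) A.arcs_symmetric[OF ab(1)] by force
  qed
  have "parcs (path_graph k) = map_prod \<phi> \<phi> ` parcs A"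
  proof
    show "parcs (path_graph k) \<subseteq> map_prod \<phi> \<phi> ` parcs A"
      using up by auto
    show "map_prod \<phi> \<phi> ` parcs A \<subseteq> parcs (path_graph k)"
    proof
      fix e assume "e \<in> map_prod \<phi> \<phi> ` parcs A"
      then obtain a b where ab: "(a, b) \<in> parcs A" and e: "e = (\<phi> a, \<phi> b)" by auto
      then have v: "a \<in> pverts A" "b \<in> pverts A" by (auto dest: A.wellformed')
      then have "\<phi> a \<in> {..<k}" "\<phi> b \<in> {..<k}" by (simp_all add: im)
      then show "e \<in> parcs (path_graph k)"
        using step[OF ab] \<phi>m[OF v(1)] \<phi>m[OF v(2)] e by auto
    qed
  qed
  then show ?thesis
    unfolding is_path_def k_def[symmetric] digraph_iso_with_proj_iff[OF A.pair_wf_digraph_axioms]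
    using inj' im by auto
qed

section \<open>Disjoint unions of cycles\<close>

text \<open>The last two disjuncts close the cycle between \<open>m\<close> and
  \<open>m + l - 1\<close>. For \<open>l = 1\<close> this would be a loop and for
  \<open>l = 2\<close> a single edge, hence the bound 3 below. The offset \<open>m\<close> lets
  cycles be laid side by side.\<close>

definition cycle_arcs :: "nat \<Rightarrow> nat \<Rightarrow> nat rel" where
  "cycle_arcs m l = {(i, j). i \<in> {m..<m + l} \<and> j \<in> {m..<m + l} \<and>
     (j = Suc i \<or> i = Suc j \<or> i = m \<and> Suc j = m + l \<or> j = m \<and> Suc i = m + l)}"

fun cycles_arcs :: "nat \<Rightarrow> nat list \<Rightarrow> nat rel" where
  "cycles_arcs m [] = {}"
| "cycles_arcs m (l # ls) = cycle_arcs m l \<union> cycles_arcs (m + l) ls"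

definition cycles_graph :: "nat list \<Rightarrow> nat pair_pre_digraph" where
  "cycles_graph ls = \<lparr>pverts = {..<sum_list ls}, parcs = cycles_arcs 0 ls\<rparr>"

lemma cycles_graph_simps [simp]:
  "pverts (cycles_graph ls) = {..<sum_list ls}"
  "parcs (cycles_graph ls) = cycles_arcs 0 ls"
  by (auto simp: cycles_graph_def)

lemma cycles_arcs_bounds:
  "(i, j) \<in> cycles_arcs m ls \<Longrightarrow>
    m \<le> i \<and> i < m + sum_list ls \<and> m \<le> j \<and> j < m + sum_list ls"
proof (induction ls arbitrary: m)
  case (Cons l ls)
  from Cons.prems consider "(i, j) \<in> cycle_arcs m l" | "(i, j) \<in> cycles_arcs (m + l) ls" by auto
  then show ?case
  proof cases
    case 2
    then show ?thesis using Cons.IH[of "m + l"] by simp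
  qed (simp add: cycle_arcs_def)
qed simp

lemma cycles_arcs_sym: "(i, j) \<in> cycles_arcs m ls \<Longrightarrow> (j, i) \<in> cycles_arcs m ls"
  by (induction ls arbitrary: m) (auto simp: cycle_arcs_def)

lemma cycles_arcs_irrefl:
  "\<forall>l\<in>set ls. 3 \<le> l \<Longrightarrow> (i, i) \<notin> cycles_arcs m ls"
  by (induction ls arbitrary: m) (auto simp: cycle_arcs_def)

lemma card_cycle_arcs_Image:
  assumes "3 \<le> l" "v \<in> {m..<m + l}"
  shows "card (cycle_arcs m l `` {v}) = 2"
proof -
  \<comment> \<open>Cyclic predecessor and successor of \<open>v\<close>; they differ because the
    cycle has at least 3 vertices.\<close>
  let ?a = "if v = m then m + l - 1 else v - 1" and ?b = "if Suc v = m + l then m else Suc v"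
  have "cycle_arcs m l `` {v} = {?a, ?b}"
    using assms by (auto simp: cycle_arcs_def split: if_splits)
  moreover have "?a \<noteq> ?b" using assms by auto
  ultimately show ?thesis by simp
qed

lemma card_cycles_arcs_Image:
  "\<forall>l\<in>set ls. 3 \<le> l \<Longrightarrow> v \<in> {m..<m + sum_list ls} \<Longrightarrow> card (cycles_arcs m ls `` {v}) = 2"
proof (induction ls arbitrary: m)
  case (Cons l ls)
  show ?case
  proof (cases "v < m + l")
    case True
    then have "cycles_arcs m (l # ls) `` {v} = cycle_arcs m l `` {v}"
      by (auto dest: cycles_arcs_bounds)
    then show ?thesis using True Cons.prems card_cycle_arcs_Image[of l v m] by simp
  next
    case False
    then have "cycles_arcs m (l # ls) `` {v} = cycles_arcs (m + l) ls `` {v}"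
      by (auto simp: cycle_arcs_def)
    then show ?thesis using False Cons.prems Cons.IH[of "m + l"] by simp
  qed
qed simp

text \<open>Locates the cycle through \<open>v\<close>: the prefix sum is where block
  \<open>i\<close> starts, and no arc leaves a block. This traps connected subgraphs inside single
  cycles.\<close>

lemma cycles_arcs_block:
  assumes "v \<in> {m..<m + sum_list ls}"
  obtains i where "i < length ls"
    "v \<in> {m + sum_list (take i ls)..<m + sum_list (take i ls) + ls ! i}"
    "\<And>x y. (x, y) \<in> cycles_arcs m ls \<Longrightarrow>
      x \<in> {m + sum_list (take i ls)..<m + sum_list (take i ls) + ls ! i} \<Longrightarrow>
      y \<in> {m + sum_list (take i ls)..<m + sum_list (take i ls) + ls ! i}"
  using assms
proof (induction ls arbitrary: m thesis)
  case (Cons l ls)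
  show ?case
  proof (cases "v < m + l")
    case True
    show ?thesis
    proof (rule Cons.prems(1)[of 0])
      fix x y
      assume "(x, y) \<in> cycles_arcs m (l # ls)"
        "x \<in> {m + sum_list (take 0 (l # ls))..<m + sum_list (take 0 (l # ls)) + (l # ls) ! 0}"
      then show "y \<in> {m + sum_list (take 0 (l # ls))..<m + sum_list (take 0 (l # ls)) + (l # ls) ! 0}"
        by (auto simp: cycle_arcs_def dest: cycles_arcs_bounds)
    qed (use True Cons.prems in auto)
  next
    case False
    then have "v \<in> {m + l..<m + l + sum_list ls}" using Cons.prems by auto
    then obtain i where i: "i < length ls"
      "v \<in> {m + l + sum_list (take i ls)..<m + l + sum_list (take i ls) + ls ! i}"
      and cl: "\<And>x y. (x, y) \<in> cycles_arcs (m + l) ls \<Longrightarrow>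
      x \<in> {m + l + sum_list (take i ls)..<m + l + sum_list (take i ls) + ls ! i} \<Longrightarrow>
      y \<in> {m + l + sum_list (take i ls)..<m + l + sum_list (take i ls) + ls ! i}"
      using Cons.IH[of "m + l"] by blast
    show ?thesis
    proof (rule Cons.prems(1)[of "Suc i"])
      fix x y
      assume "(x, y) \<in> cycles_arcs m (l # ls)"
        "x \<in> {m + sum_list (take (Suc i) (l # ls))..<
          m + sum_list (take (Suc i) (l # ls)) + (l # ls) ! Suc i}"
      then show "y \<in> {m + sum_list (take (Suc i) (l # ls))..<
          m + sum_list (take (Suc i) (l # ls)) + (l # ls) ! Suc i}"
        using cl[of x y] by (auto simp: cycle_arcs_def add.assoc)
    qed (use i in \<open>auto simp: add.assoc\<close>)
  qed
qed simp

lemma pair_graph_cycles_graph: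
  assumes "\<forall>l\<in>set ls. 3 \<le> l"
  shows "pair_graph (cycles_graph ls)"
proof
  have "parcs (cycles_graph ls) \<subseteq> {..<sum_list ls} \<times> {..<sum_list ls}"
    by (auto dest: cycles_arcs_bounds)
  then show "finite (parcs (cycles_graph ls))"
    by (rule finite_subset) simp
  show "symmetric (with_proj (cycles_graph ls))"
    by (auto simp: symmetric_def intro!: symI cycles_arcs_sym)
  fix e assume e: "e \<in> parcs (cycles_graph ls)"
  show "fst e \<in> pverts (cycles_graph ls)" "snd e \<in> pverts (cycles_graph ls)" "fst e \<noteq> snd e"
    using e cycles_arcs_bounds[of "fst e" "snd e" 0 ls] cycles_arcs_irrefl[OF assms]
    by (auto simp: prod_eq_iff) (metis prod.collapse)
qed simp

lemma out_degree_with_proj: "out_degree (with_proj G) v = card (parcs G `` {v})"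
proof -
  have "out_arcs (with_proj G) v = Pair v ` (parcs G `` {v})"
    by (auto simp: out_arcs_def)
  then show ?thesis by (simp add: out_degree_def card_image inj_on_def)
qed

lemma regular_graph_cycles_graph:
  assumes "\<forall>l\<in>set ls. 3 \<le> l"
  shows "regular_graph (cycles_graph ls)"
  using card_cycles_arcs_Image[OF assms, of _ 0]
  unfolding regular_graph_def out_degree_with_proj by auto

section \<open>Vanishing of the regular extremal number\<close>

text \<open>Needed to reason about \<open>Max\<close>: infinitely many graphs on \<nat> qualify as
  candidates, but their edge counts are bounded.\<close>

lemma finite_num_edges:
  "finite {num_edges G | G :: nat pair_pre_digraph.
     pair_graph G \<and> card (pverts G) = n \<and> regular_graph G \<and> \<not> contains_copy G F}"
proof (rule finite_subset)
  show "{num_edges G | G :: nat pair_pre_digraph.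
     pair_graph G \<and> card (pverts G) = n \<and> regular_graph G \<and> \<not> contains_copy G F} \<subseteq> {..n * n}"
  proof
    fix e assume "e \<in> {num_edges G | G :: nat pair_pre_digraph.
      pair_graph G \<and> card (pverts G) = n \<and> regular_graph G \<and> \<not> contains_copy G F}"
    then obtain G :: "nat pair_pre_digraph"
      where e: "e = num_edges G" and G: "pair_graph G" and n: "card (pverts G) = n"
      by blast
    interpret G: pair_graph G by fact
    have "num_edges G \<le> card (parcs G)"
      unfolding num_edges_def by (rule card_image_le) (rule G.pair_finite_arcs)
    also have "\<dots> \<le> card (pverts G \<times> pverts G)"
      by (rule card_mono) (auto simp: G.pair_finite_verts dest: G.wellformed')
    finally show "e \<in> {..n * n}"
      by (simp add: card_cartesian_product e n)
  qed
qed simp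

lemma num_edges_eq_0_iff: "finite (parcs G) \<Longrightarrow> num_edges G = 0 \<longleftrightarrow> parcs G = {}"
  by (auto simp: num_edges_def)

lemma rex_nonzero:
  fixes G :: "nat pair_pre_digraph"
  assumes "pair_graph G" "regular_graph G" "\<not> contains_copy G F" "parcs G \<noteq> {}"
  shows "rex (card (pverts G)) F \<noteq> 0"
proof -
  interpret G: pair_graph G by fact
  have "num_edges G \<noteq> 0"
    using num_edges_eq_0_iff[OF G.pair_finite_arcs] assms by simp
  moreover have "num_edges G \<le> rex (card (pverts G)) F"
    unfolding rex_def by (rule Max_ge[OF finite_num_edges]) (use assms in blast)
  ultimately show ?thesis by simp
qed

lemma rex_eq_0I:
  assumes F: "pair_wf_digraph F" "parcs F \<noteq> {}"
    and copy: "\<And>G :: nat pair_pre_digraph. pair_graph G \<Longrightarrow> card (pverts G) = n \<Longrightarrow>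
      regular_graph G \<Longrightarrow> parcs G \<noteq> {} \<Longrightarrow> contains_copy G F"
  shows "rex n F = 0"
proof -
  let ?P = "\<lambda>G :: nat pair_pre_digraph.
    pair_graph G \<and> card (pverts G) = n \<and> regular_graph G \<and> \<not> contains_copy G F"
  \<comment> \<open>The edgeless graph is free of \<open>F\<close> because \<open>F\<close> has an
    edge, so the maximum is over \<open>{0}\<close> and not over the empty set.\<close>
  let ?E = "\<lparr>pverts = {..<n}, parcs = {}\<rparr>"
  have E: "pair_graph ?E" by unfold_locales (auto simp: symmetric_def)
  then have wf: "pair_wf_digraph ?E"
    using pair_graph_def pair_digraph.pair_wf_digraph by blast
  have "\<not> contains_copy ?E F"
    using F by (auto simp: contains_copy_iff_embedding[OF F(1) wf] embedding_def)
  with E have "?P ?E"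
    by (auto simp: regular_graph_def out_degree_with_proj)
  moreover have "num_edges G = 0" if "?P G" for G
  proof -
    have "parcs G = {}" using that copy[of G] by blast
    then show ?thesis by (simp add: num_edges_def)
  qed
  ultimately have "{num_edges G | G. ?P G} = {0}"
    by (auto intro!: exI[of _ ?E])
  then show ?thesis by (simp add: rex_def)
qed

section \<open>Free 2-regular graphs\<close>

text \<open>Common frame of the three constructions: it remains to choose cycle lengths with sum
  \<open>n\<close> that leave no room for \<open>F\<close>.\<close>

lemma cycles_graph_rex_nonzero:
  assumes "\<forall>l\<in>set ls. 3 \<le> l" "ls \<noteq> []" "pair_wf_digraph F"
    and "\<And>\<phi>. embedding \<phi> F (cycles_graph ls) \<Longrightarrow> False"
  shows "rex (sum_list ls) F \<noteq> 0"
proof -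
  have G: "pair_graph (cycles_graph ls)" by (rule pair_graph_cycles_graph) fact
  interpret G: pair_graph "cycles_graph ls" by fact
  \<comment> \<open>Vertex 0 exists and has two neighbours, so the graph has an edge.\<close>
  have "0 < sum_list ls" using assms(1,2) by (cases ls) auto
  then have "cycles_arcs 0 ls `` {0} \<noteq> {}"
    using card_cycles_arcs_Image[OF assms(1), of 0 0] by fastforce
  then have "parcs (cycles_graph ls) \<noteq> {}" by auto
  moreover have "\<not> contains_copy (cycles_graph ls) F"
    using assms(3,4) G.pair_wf_digraph_axioms by (auto simp: contains_copy_iff_embedding)
  ultimately show ?thesis
    using rex_nonzero[OF G regular_graph_cycles_graph] assms(1) by fastforce
qed

text \<open>The preimage of the block containing the image of \<open>u\<close> is closed under the
  arcs of \<open>F\<close>, hence contains the component.\<close>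

lemma embedding_component_block:
  assumes "embedding \<phi> F (cycles_graph ls)" "u \<in> pverts F"
  obtains i where "i < length ls"
    "\<phi> ` component F u \<subseteq> {sum_list (take i ls)..<sum_list (take i ls) + ls ! i}"
proof -
  have "\<phi> u \<in> {0..<0 + sum_list ls}" using assms by (auto simp: embedding_def)
  then obtain i where i: "i < length ls"
    "\<phi> u \<in> {0 + sum_list (take i ls)..<0 + sum_list (take i ls) + ls ! i}"
    and cl: "\<And>x y. (x, y) \<in> cycles_arcs 0 ls \<Longrightarrow>
      x \<in> {0 + sum_list (take i ls)..<0 + sum_list (take i ls) + ls ! i} \<Longrightarrow>
      y \<in> {0 + sum_list (take i ls)..<0 + sum_list (take i ls) + ls ! i}"
    by (rule cycles_arcs_block) blast
  have "component F u \<subseteq> \<phi> -` {0 + sum_list (take i ls)..<0 + sum_list (take i ls) + ls ! i}"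
  proof (rule component_least)
    fix x y
    assume "(x, y) \<in> parcs F" "x \<in> \<phi> -` {0 + sum_list (take i ls)..<0 + sum_list (take i ls) + ls ! i}"
    then show "y \<in> \<phi> -` {0 + sum_list (take i ls)..<0 + sum_list (take i ls) + ls ! i}"
      using cl[of "\<phi> x" "\<phi> y"] assms(1) by (simp add: embedding_def)
  qed (use i in simp)
  then show thesis using that[OF i(1)] by auto
qed

lemma (in pair_wf_digraph) embedding_component_block_card:
  assumes "embedding \<phi> G (cycles_graph ls)" "u \<in> pverts G"
  obtains i where "i < length ls" "card (component G u) \<le> ls ! i"
    "\<phi> ` component G u \<subseteq> {sum_list (take i ls)..<sum_list (take i ls) + ls ! i}"
proof -
  obtain i where i: "i < length ls"
    "\<phi> ` component G u \<subseteq> {sum_list (take i ls)..<sum_list (take i ls) + ls ! i}"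
    using assms by (rule embedding_component_block)
  have "inj_on \<phi> (component G u)"
    using assms(1) component_subset[OF assms(2)] by (rule embedding_inj_on)
  then have "card (component G u) \<le> ls ! i"
    using card_mono[OF _ i(2)] by (simp add: card_image)
  then show thesis using that i by blast
qed

lemma (in pair_graph) rex_nonzero_large_component:
  assumes "u \<in> pverts G" "5 \<le> card (component G u)" "8 \<le> n"
  shows "rex n G \<noteq> 0"
proof -
  define q r where "q = n div 3" and "r = n mod 3"
  have n: "n = 3 * q + r" and "r < 3" by (simp_all add: q_def r_def)
  \<comment> \<open>Since \<open>n = 3 * (q - r) + 4 * r\<close>, the remainder is absorbed by
    enlarging \<open>r\<close> triangles to 4-cycles; \<open>8 \<le> n\<close> ensures that
    \<open>q\<close> is at least 2 and so at least \<open>r\<close>.\<close>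
  let ?ls = "replicate (q - r) 3 @ replicate r 4 :: nat list"
  have "r \<le> q" using n \<open>r < 3\<close> assms(3) by linarith
  then have sum: "sum_list ?ls = n" by (simp add: sum_list_replicate n diff_mult_distrib)
  have "rex (sum_list ?ls) G \<noteq> 0"
  proof (rule cycles_graph_rex_nonzero)
    show "?ls \<noteq> []" using n \<open>r < 3\<close> assms(3) by simp
    fix \<phi> assume "embedding \<phi> G (cycles_graph ?ls)"
    then obtain i where "i < length ?ls" "card (component G u) \<le> ?ls ! i"
      using assms(1) by (rule embedding_component_block_card) blast
    moreover from this(1) have "?ls ! i \<in> set ?ls" by (rule nth_mem)
    then have "?ls ! i \<le> 4" by auto
    ultimately show False using assms(2) by linarith
  qed (auto intro: pair_wf_digraph_axioms)
  then show ?thesis unfolding sum .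
qed

lemma (in pair_graph) rex_nonzero_two_P4:
  assumes "u \<in> pverts G" "v \<in> pverts G" "card (component G u) = 4" "card (component G v) = 4"
    and disj: "component G u \<inter> component G v = {}" and "3 \<le> n"
  shows "rex n G \<noteq> 0"
proof -
  \<comment> \<open>One cycle of length 3, 4 or 5 takes up the remainder of \<open>n\<close>, and
    all others are triangles.\<close>
  define r k where "r = 3 + n mod 3" and "k = n div 3 - 1"
  have "1 \<le> n div 3" using div_le_mono[OF \<open>3 \<le> n\<close>, of 3] by simp
  then have rk: "3 \<le> r" "r \<le> 5" "n = r + k * 3"
    using mod_less_divisor[of 3 n] div_mult_mod_eq[of n 3] unfolding r_def k_def
    by (simp, linarith, linarith)
  let ?ls = "r # replicate k 3"
  have sum: "sum_list ?ls = n" using rk by (simp add: sum_list_replicate)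
  have "rex (sum_list ?ls) G \<noteq> 0"
  proof (rule cycles_graph_rex_nonzero)
    fix \<phi> assume \<phi>: "embedding \<phi> G (cycles_graph ?ls)"
    have sub: "\<phi> ` component G w \<subseteq> {0..<r}"
      if w: "w \<in> pverts G" "card (component G w) = 4" for w
    proof -
      obtain i where i: "i < length ?ls" "card (component G w) \<le> ?ls ! i"
        "\<phi> ` component G w \<subseteq> {sum_list (take i ?ls)..<sum_list (take i ?ls) + ?ls ! i}"
        using \<phi> w(1) by (rule embedding_component_block_card) blast
      \<comment> \<open>Four vertices do not fit into a triangle, so both components land in the
        first cycle; together they need 8 places, but it has at most 5.\<close>
      have "i = 0" using i(1,2) w(2) by (cases i) auto
      then show ?thesis using i(3) by simp
    qed
    let ?C = "component G u \<union> component G v"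
    have "?C \<subseteq> pverts G" using component_subset assms by blast
    then have "inj_on \<phi> ?C" and "finite ?C"
      using embedding_inj_on[OF \<phi>] finite_subset[OF _ pair_finite_verts] by blast+
    then have "card ?C \<le> card {0..<r}"
      using sub[of u] sub[of v] assms by (intro card_inj_on_le[of \<phi>]) auto
    moreover have "card ?C = 8"
      using \<open>finite ?C\<close> disj assms by (simp add: card_Un_disjoint)
    ultimately show False using rk by auto
  qed (use rk pair_wf_digraph_axioms in auto)
  then show ?thesis unfolding sum .
qed

text \<open>With fewer than \<open>n\<close> vertices, \<open>G\<close> misses some vertex of the
  cycle, and the cycle cut open there is a path.\<close>

lemma (in pair_graph) component_is_pathI:
  assumes u: "u \<in> pverts G" and "card (pverts G) < n"
    and \<phi>: "embedding \<phi> G (cycles_graph [n])"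
  shows "is_path (card (component G u)) (with_proj (induced G (component G u)))"
proof -
  let ?C = "component G u"
  have C: "?C \<subseteq> pverts G" using u by (rule component_subset)
  have inj: "inj_on \<phi> ?C" using \<phi> C by (rule embedding_inj_on)
  have ran: "\<phi> x < n" if "x \<in> ?C" for x
    using \<phi> C that by (auto simp: embedding_def)
  have "card (\<phi> ` ?C) < card {..<n}"
    using inj card_mono[OF pair_finite_verts C] assms(2) by (simp add: card_image)
  then obtain w where w: "w < n" "w \<notin> \<phi> ` ?C"
    by (metis card_mono finite_imageI finite_subset[OF C pair_finite_verts] lessThan_iff
        not_le subsetI)
  \<comment> \<open>Rotating the cycle so that the missed vertex comes last turns its remainder into an
      interval of integers.\<close>
  define rot where "rot i = (if w < i then i - w - 1 else i + n - w - 1)" for i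
  have "inj_on rot {..<n}"
    using w(1) by (auto simp: inj_on_def rot_def split: if_splits)
  then have "inj_on rot (\<phi> ` ?C)" by (rule inj_on_subset) (use ran in auto)
  with inj have inj': "inj_on (rot \<circ> \<phi>) ?C" by (rule comp_inj_on)
  have adj: "rot j = Suc (rot i) \<or> rot i = Suc (rot j)"
    if "(i, j) \<in> cycles_arcs 0 [n]" "i \<noteq> w" "j \<noteq> w" for i j
    using that w(1) by (auto simp: rot_def cycle_arcs_def)
  have "is_path (card (pverts (induced G ?C))) (with_proj (induced G ?C))"
  proof (rule is_pathI_integer_embedding[where \<psi> = "rot \<circ> \<phi>"])
    show "pair_sym_digraph (induced G ?C)" by (rule pair_sym_digraph_induced)
    show "finite (pverts (induced G ?C))" using finite_subset[OF C pair_finite_verts] by simp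
    show "pverts (induced G ?C) \<noteq> {}" using component_refl by fastforce
    show "inj_on (rot \<circ> \<phi>) (pverts (induced G ?C))" using inj' by simp
  next
    fix T x assume x: "x \<in> pverts (induced G ?C)" "x \<in> T"
      and cl: "\<And>a b. (a, b) \<in> parcs (induced G ?C) \<Longrightarrow> a \<in> T \<Longrightarrow> b \<in> T"
    \<comment> \<open>Rebasing the component at \<open>x\<close> makes
      \<open>component_least\<close> applicable from an arbitrary starting vertex.\<close>
    have eq: "component G x = ?C" using x by (simp add: component_eq)
    have "component G x \<subseteq> T"
    proof (rule component_least)
      fix a b assume "(a, b) \<in> parcs G" "a \<in> component G x" "a \<in> T"
      then show "b \<in> T" using cl[of a b] component_closed[of a b G x] eq by simp
    qed (rule x)
    then show "pverts (induced G ?C) \<subseteq> T" using eq by simp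
  next
    fix a b assume ab: "(a, b) \<in> parcs (induced G ?C)"
    then have "\<phi> a \<noteq> w" "\<phi> b \<noteq> w" using w(2) by auto
    moreover have "(\<phi> a, \<phi> b) \<in> cycles_arcs 0 [n]"
      using ab \<phi> by (simp add: embedding_def)
    ultimately show "(rot \<circ> \<phi>) b = Suc ((rot \<circ> \<phi>) a) \<or> (rot \<circ> \<phi>) a = Suc ((rot \<circ> \<phi>) b)"
      using adj[of "\<phi> a" "\<phi> b"] by simp
  qed
  then show ?thesis by simp
qed

lemma (in pair_graph) rex_nonzero_not_path:
  assumes "u \<in> pverts G" "card (pverts G) < n" "3 \<le> n"
    and "\<not> is_path (card (component G u)) (with_proj (induced G (component G u)))"
  shows "rex n G \<noteq> 0"
proof -
  have "rex (sum_list [n]) G \<noteq> 0"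
    by (rule cycles_graph_rex_nonzero)
      (use assms component_is_pathI pair_wf_digraph_axioms in auto)
  then show ?thesis by simp
qed

section \<open>Paths in regular graphs\<close>

lemma (in pair_graph) card_parcs_regular:
  assumes "\<And>v. v \<in> pverts G \<Longrightarrow> card (parcs G `` {v}) = d"
  shows "card (parcs G) = card (pverts G) * d"
proof -
  have "parcs G = (SIGMA v:pverts G. parcs G `` {v})"
    by (auto dest: wellformed')
  moreover have "card (SIGMA v:pverts G. parcs G `` {v}) = (\<Sum>v\<in>pverts G. card (parcs G `` {v}))"
    by (rule card_SigmaI) (auto simp: pair_finite_verts finite_Image pair_finite_arcs)
  ultimately show ?thesis using assms by simp
qed

text \<open>The order on \<nat> splits the arcs into ascending and descending ones, and
  \<open>prod.swap\<close> matches the two halves. With \<open>card_parcs_regular\<close> this makes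
  the degree even when the order of the graph is odd.\<close>

lemma even_card_parcs:
  fixes G :: "nat pair_pre_digraph"
  assumes "pair_graph G"
  shows "even (card (parcs G))"
proof -
  interpret pair_graph G by fact
  let ?A = "{(u, v) \<in> parcs G. u < v}" and ?B = "{(u, v) \<in> parcs G. v < u}"
  have "card (parcs G) = card (?A \<union> ?B)"
    by (rule arg_cong[of _ _ card]) (use no_loops' in \<open>auto simp: neq_iff\<close>)
  also have "\<dots> = card ?A + card ?B"
    using pair_finite_arcs
    by (intro card_Un_disjoint) (auto intro: finite_subset[of _ "parcs G"])
  finally have "card (parcs G) = card ?A + card ?B" .
  moreover have "bij_betw prod.swap ?A ?B"
    by (rule bij_betw_byWitness[of _ prod.swap]) (auto dest: arcs_symmetric)
  then have "card ?A = card ?B" by (rule bij_betw_same_card)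
  ultimately show ?thesis by simp
qed

lemma path_graph_embeddingI:
  assumes "pair_sym_digraph G" "length xs = k" "distinct xs" "set xs \<subseteq> pverts G"
    and "\<And>i. Suc i < k \<Longrightarrow> (xs ! i, xs ! Suc i) \<in> parcs G"
  shows "embedding ((!) xs) (path_graph k) G"
proof -
  interpret pair_sym_digraph G by fact
  show ?thesis
    using assms(2-5) by (auto simp: embedding_def inj_on_def nth_eq_iff_index_eq arcs_symmetric)
qed

lemma obtain_two_elements:
  assumes "2 \<le> card X" obtains a b where "a \<in> X" "b \<in> X" "a \<noteq> b"
proof -
  obtain Y where "Y \<subseteq> X" "card Y = 2" using obtain_subset_with_card_n[OF assms] by blast
  then show thesis using that by (auto simp: card_2_iff)
qed

context pair_graph
begin

text \<open>A centre \<open>c\<close> outside \<open>S\<close> with two neighbours outside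
  \<open>S\<close> is enough. The bound on \<open>card S\<close> is that of a closed neighbourhood,
  \<open>s + s * d\<close> with \<open>d\<close> at most \<open>s + 2\<close>, where
  \<open>s = card S\<close>.\<close>

lemma ex_P3_avoiding:
  assumes reg: "\<And>v. v \<in> pverts G \<Longrightarrow> card (parcs G `` {v}) = d" and "2 \<le> d"
    and S: "finite S" "S \<subseteq> pverts G" "card S * (card S + 3) < card (pverts G)"
  obtains \<phi> where "embedding \<phi> (path_graph 3) G" "\<phi> ` {..<3} \<inter> S = {}"
proof -
  have fin: "finite (parcs G `` {v})" for v
    using pair_finite_arcs by (simp add: finite_Image)
  have "\<exists>c \<in> pverts G - S. 2 \<le> card (parcs G `` {c} - S)"
  \<comment> \<open>For large degree any vertex outside \<open>S\<close> serves, since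
    \<open>S\<close> takes at most \<open>card S\<close> of its neighbours.\<close>
  proof (cases "card S + 2 \<le> d")
    case True
    have "card S \<le> card S * (card S + 3)" by simp
    then have "card S < card (pverts G)" using S(3) by linarith
    then obtain c where c: "c \<in> pverts G - S"
      using S(1) by (metis card_mono not_less Diff_iff subsetI)
    then have "card (parcs G `` {c}) - card S \<le> card (parcs G `` {c} - S)"
      using S(1) by (intro diff_card_le_card_Diff)
    then show ?thesis using c True reg[of c] by (intro bexI[of _ c]) auto
  next
    case False
    \<comment> \<open>For small degree the closed neighbourhood of \<open>S\<close> cannot cover the
      graph; by symmetry a vertex outside it has no neighbour in \<open>S\<close>.\<close>
    let ?N = "S \<union> (\<Union>v\<in>S. parcs G `` {v})"
    have "card ?N \<le> card S + (\<Sum>v\<in>S. card (parcs G `` {v}))"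
      by (intro order.trans[OF card_Un_le] add_left_mono card_UN_le S)
    also have "(\<Sum>v\<in>S. card (parcs G `` {v})) = card S * d"
      using reg S(2) by (simp add: subset_iff)
    also have "card S + card S * d \<le> card S * (card S + 3)"
    proof -
      have "card S * d \<le> card S * (card S + 2)" using False by (intro mult_left_mono) auto
      then show ?thesis by (simp add: algebra_simps)
    qed
    also note S(3)
    finally have "card ?N < card (pverts G)" .
    then have "\<not> pverts G \<subseteq> ?N"
      using card_mono[of ?N "pverts G"] S(1) fin by auto
    then obtain c where c: "c \<in> pverts G" "c \<notin> ?N" by blast
    then have "parcs G `` {c} - S = parcs G `` {c}"
      using arcs_symmetric by blast
    then show ?thesis using c reg[of c] \<open>2 \<le> d\<close> by (intro bexI[of _ c]) auto
  qed
  then obtain c a b where c: "c \<in> pverts G - S" and ab: "a \<in> parcs G `` {c} - S"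
    "b \<in> parcs G `` {c} - S" "a \<noteq> b"
    by (meson obtain_two_elements)
  then have arcs: "(a, c) \<in> parcs G" "(c, b) \<in> parcs G" by (auto intro: arcs_symmetric)
  have "embedding ((!) [a, c, b]) (path_graph 3) G"
    by (rule path_graph_embeddingI[OF pair_sym_digraph_axioms])
      (use arcs ab no_loops' in \<open>auto simp: less_Suc_eq numeral_eq_Suc dest: wellformed'\<close>)
  moreover have "(!) [a, c, b] ` {..<3} \<inter> S = {}"
    using c ab by (auto simp: less_Suc_eq numeral_eq_Suc)
  ultimately show thesis by (rule that)
qed

text \<open>Without a \<open>P\<^sub>4\<close> all closed neighbourhoods are triangles, and these
  partition the vertices, so their number would be divisible by 3.\<close>

lemma ex_P4:
  assumes reg: "\<And>v. v \<in> pverts G \<Longrightarrow> card (parcs G `` {v}) = d" and "2 \<le> d"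
    and ndvd: "\<not> 3 dvd card (pverts G)"
  obtains \<phi> where "embedding \<phi> (path_graph 4) G"
proof (rule ccontr)
  assume "\<not> thesis"
  then have noP4: "\<not> embedding \<phi> (path_graph 4) G" for \<phi> using that by blast
  \<comment> \<open>Any other \<open>b\<close> would complete the path \<open>a\<close>,
    \<open>u\<close>, \<open>v\<close>, \<open>b\<close>.\<close>
  have sub: "b \<in> {u, a}"
    if arcs: "(u, v) \<in> parcs G" "(u, a) \<in> parcs G" "a \<noteq> v" "(v, b) \<in> parcs G" for u v a b
  proof (rule ccontr)
    assume "b \<notin> {u, a}"
    then have "embedding ((!) [a, u, v, b]) (path_graph 4) G"
      using arcs no_loops' arcs_symmetric
      by (intro path_graph_embeddingI[OF pair_sym_digraph_axioms])
        (auto simp: less_Suc_eq numeral_eq_Suc dest: wellformed')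
    then show False using noP4 by blast
  qed
  \<comment> \<open>The containment leaves at most two neighbours, while the degree is at least 2,
    so equality holds.\<close>
  have tri: "parcs G `` {v} = {u, a}"
    if arcs: "(u, v) \<in> parcs G" "(u, a) \<in> parcs G" "a \<noteq> v" for u v a
  proof (rule card_subset_eq)
    show s: "parcs G `` {v} \<subseteq> {u, a}" using sub[OF arcs] by blast
    have "card (parcs G `` {v}) \<le> card {u, a}" by (rule card_mono) (use s in auto)
    moreover have "card (parcs G `` {v}) = d" using reg arcs by (blast dest: wellformed')
    moreover have "card {u, a} \<le> 2" by (simp add: card_insert_if)
    ultimately show "card (parcs G `` {v}) = card {u, a}" using \<open>2 \<le> d\<close> by linarith
  qed simp
  define N where "N v = insert v (parcs G `` {v})" for v
  have other: "\<exists>a. (u, a) \<in> parcs G \<and> a \<noteq> v" if "u \<in> pverts G" for u v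
  proof -
    have "2 \<le> card (parcs G `` {u})" using reg[OF that] \<open>2 \<le> d\<close> by simp
    then obtain a b where "a \<in> parcs G `` {u}" "b \<in> parcs G `` {u}" "a \<noteq> b"
      by (rule obtain_two_elements)
    then show ?thesis by (cases "a = v") auto
  qed
  \<comment> \<open>\<open>tri\<close> is applied twice: the first use yields the arc from
    \<open>v\<close> to \<open>a\<close>, which permits the second with \<open>u\<close> and
    \<open>v\<close> exchanged.\<close>
  have N3: "N u = {u, v, a} \<and> N v = {u, v, a} \<and> u \<noteq> v \<and> u \<noteq> a"
    if arcs: "(u, v) \<in> parcs G" "(u, a) \<in> parcs G" "a \<noteq> v" for u v a
  proof -
    have "parcs G `` {v} = {u, a}" using arcs by (rule tri)
    moreover from this have "(v, a) \<in> parcs G" "a \<noteq> u"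
      using no_loops' arcs by auto
    then have "parcs G `` {u} = {v, a}"
      using tri[of v u a] arcs_symmetric[OF arcs(1)] by blast
    ultimately show ?thesis using no_loops' arcs by (auto simp: N_def)
  qed
  have N_eq: "N x = N u" if u: "u \<in> pverts G" "x \<in> N u" for u x
  proof (cases "x = u")
    case False
    then have ux: "(u, x) \<in> parcs G" using u(2) by (simp add: N_def)
    obtain a where "(u, a) \<in> parcs G" "a \<noteq> x" using other u(1) by blast
    then show ?thesis using N3[OF ux] by auto
  qed simp
  have N_card: "card (N u) = 3" if u: "u \<in> pverts G" for u
  proof -
    obtain v where v: "(u, v) \<in> parcs G" using other u by blast
    obtain a where "(u, a) \<in> parcs G" "a \<noteq> v" using other u by blast
    then show ?thesis using N3[OF v] by auto
  qed
  have "\<Union> (N ` pverts G) = pverts G" by (auto simp: N_def dest: wellformed')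
  moreover have "3 * card (N ` pverts G) = card (\<Union> (N ` pverts G))"
  proof (rule card_partition)
    show "finite (\<Union> (N ` pverts G))" using calculation pair_finite_verts by simp
    fix c1 c2 assume c: "c1 \<in> N ` pverts G" "c2 \<in> N ` pverts G" "c1 \<noteq> c2"
    then obtain u v where uv: "u \<in> pverts G" "v \<in> pverts G" "c1 = N u" "c2 = N v" by blast
    show "c1 \<inter> c2 = {}"
    proof (rule ccontr)
      assume "c1 \<inter> c2 \<noteq> {}"
      then obtain x where "x \<in> N u" "x \<in> N v" using uv by blast
      then show False using N_eq[of u x] N_eq[of v x] uv c(3) by simp
    qed
  qed (use N_card pair_finite_verts in auto)
  ultimately show False using ndvd by (metis dvd_triv_left)
qed

end

lemma embedding_path_graph_mono:
  "j \<le> k \<Longrightarrow> embedding \<phi> (path_graph k) G \<Longrightarrow> embedding \<phi> (path_graph j) G"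
  by (auto simp: embedding_def inj_on_def)

section \<open>Greedy embedding\<close>

text \<open>Induction on \<open>\<D>\<close>: each new member is placed off the image of all earlier
  ones, a set of at most \<open>card (pverts F)\<close> vertices. \<open>D0\<close> has to be placed
  first, because \<open>ext\<close> lets only members of \<open>\<D>\<close> avoid a given
  set.\<close>

lemma embedding_family:
  fixes F :: "'a pair_pre_digraph" and G :: "'b pair_pre_digraph"
  assumes "finite \<D>" and D0: "embedding \<phi>0 (induced F D0) G"
    and ext: "\<And>D S. D \<in> \<D> \<Longrightarrow> finite S \<Longrightarrow> S \<subseteq> pverts G \<Longrightarrow> card S \<le> card (pverts F) \<Longrightarrow>
      \<exists>\<phi>. embedding \<phi> (induced F D) G \<and> \<phi> ` D \<inter> S = {}"
    and sub: "\<And>D. D \<in> insert D0 \<D> \<Longrightarrow> D \<subseteq> pverts F" and fin: "finite (pverts F)"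
    and disj: "\<And>D E. D \<in> insert D0 \<D> \<Longrightarrow> E \<in> insert D0 \<D> \<Longrightarrow> D \<noteq> E \<Longrightarrow> D \<inter> E = {}"
  shows "\<exists>\<phi>. inj_on \<phi> (\<Union>(insert D0 \<D>)) \<and> \<phi> ` \<Union>(insert D0 \<D>) \<subseteq> pverts G \<and>
    (\<forall>D\<in>insert D0 \<D>. embedding \<phi> (induced F D) G)"
  using assms(1) ext sub disj
proof (induction \<D>)
  case empty
  then show ?case using D0 by (intro exI[of _ \<phi>0]) (simp add: embedding_def)
next
  case (insert D \<D>)
  show ?case
  proof (cases "D = D0")
    case True
    then show ?thesis using insert by simp
  next
    case False
    let ?U = "\<Union>(insert D0 \<D>)"
    have "\<exists>\<phi>. inj_on \<phi> ?U \<and> \<phi> ` ?U \<subseteq> pverts G \<and>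
      (\<forall>D\<in>insert D0 \<D>. embedding \<phi> (induced F D) G)"
    proof (rule insert.IH)
      show "\<exists>\<phi>. embedding \<phi> (induced F E) G \<and> \<phi> ` E \<inter> S = {}"
        if "E \<in> \<D>" "finite S" "S \<subseteq> pverts G" "card S \<le> card (pverts F)" for E S
        using insert.prems(1)[of E S] that by simp
      show "E \<subseteq> pverts F" if "E \<in> insert D0 \<D>" for E
        using insert.prems(2)[of E] that by blast
      show "E \<inter> E' = {}" if "E \<in> insert D0 \<D>" "E' \<in> insert D0 \<D>" "E \<noteq> E'" for E E'
        using insert.prems(3)[of E E'] that by blast
    qed
    then obtain \<phi> where \<phi>: "inj_on \<phi> ?U" "\<phi> ` ?U \<subseteq> pverts G"
      "\<forall>E\<in>insert D0 \<D>. embedding \<phi> (induced F E) G"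
      by (elim exE conjE) (rule that)
    have U: "?U \<subseteq> pverts F" using insert.prems(2) by blast
    then have finU: "finite ?U" using fin by (rule finite_subset)
    have "card (\<phi> ` ?U) \<le> card ?U" using finU by (rule card_image_le)
    also have "\<dots> \<le> card (pverts F)" using fin U by (rule card_mono)
    finally obtain \<psi> where \<psi>: "embedding \<psi> (induced F D) G" "\<psi> ` D \<inter> \<phi> ` ?U = {}"
      using insert.prems(1)[of D "\<phi> ` ?U"] finU \<phi>(2) by auto
    have DU: "D \<inter> E = {}" if "E \<in> insert D0 \<D>" for E
      using insert.prems(3)[of D E] that False insert.hyps by auto
    \<comment> \<open>The two maps can be glued because \<open>D\<close> is disjoint from every
      earlier member and its image from the earlier image.\<close>
    define \<chi> where "\<chi> x = (if x \<in> D then \<psi> x else \<phi> x)" for x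
    have \<chi>D: "\<chi> x = \<psi> x" if "x \<in> D" for x using that by (simp add: \<chi>_def)
    have \<chi>U: "\<chi> x = \<phi> x" if "x \<in> E" "E \<in> insert D0 \<D>" for x E
      using that DU[of E] by (auto simp: \<chi>_def)
    have \<chi>U': "\<chi> x = \<phi> x" if "x \<in> ?U" for x
      using that by (rule UnionE) (rule \<chi>U)
    have cong: "embedding \<chi> (induced F E) G" if "embedding \<theta> (induced F E) G"
      "\<And>x. x \<in> E \<Longrightarrow> \<chi> x = \<theta> x" for \<theta> E
    proof -
      have "inj_on \<chi> E = inj_on \<theta> E" "\<chi> ` E = \<theta> ` E"
        using inj_on_cong[of E \<chi> \<theta>] image_cong[of E E \<chi> \<theta>] that(2) by simp_all
      then show ?thesis using that by (simp add: embedding_def)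
    qed
    have img: "\<chi> ` D = \<psi> ` D" "\<chi> ` ?U = \<phi> ` ?U"
      by (rule image_cong[OF refl \<chi>D], assumption) (rule image_cong[OF refl \<chi>U'])
    have "\<chi> ` (D - ?U) \<inter> \<chi> ` (?U - D) \<subseteq> \<chi> ` D \<inter> \<chi> ` ?U"
      by (intro Int_mono image_mono) blast+
    then have "\<chi> ` (D - ?U) \<inter> \<chi> ` (?U - D) = {}"
      unfolding img \<psi>(2) by (rule subset_empty[THEN iffD1])
    moreover have "inj_on \<chi> D" using cong[OF \<psi>(1) \<chi>D] embedding_inj_on by fastforce
    moreover have "inj_on \<chi> ?U"
      using \<phi>(1) inj_on_cong[OF \<chi>U'] by (rule iffD2[rotated])
    ultimately have "inj_on \<chi> (D \<union> ?U)" unfolding inj_on_Un by (intro conjI)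
    moreover have "\<chi> ` (D \<union> ?U) \<subseteq> pverts G"
      unfolding image_Un img using \<psi>(1) \<phi>(2) by (intro Un_least) (simp_all add: embedding_def)
    moreover have "embedding \<chi> (induced F E) G" if "E \<in> insert D0 (insert D \<D>)" for E
    proof (cases "E = D")
      case True
      then show ?thesis using cong[OF \<psi>(1)] \<chi>D by simp
    next
      case False
      then have "E \<in> insert D0 \<D>" using that by blast
      then show ?thesis using cong[of \<phi> E] \<phi>(3) \<chi>U[of _ E] by simp
    qed
    ultimately show ?thesis
      by (intro exI[of _ \<chi>]) (simp add: insert_commute Un_left_commute)
  qed
qed

text \<open>The \<open>P\<^sub>4\<close> component, if present, takes the role of \<open>D0\<close>
  and goes to any \<open>P\<^sub>4\<close> of \<open>H\<close>. Every other component fits into a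
  \<open>P\<^sub>3\<close>, which can be found away from all vertices used so far.\<close>

lemma (in pair_graph) embedding_of_small_paths:
  fixes H :: "nat pair_pre_digraph"
  assumes H: "pair_graph H" and reg: "\<And>v. v \<in> pverts H \<Longrightarrow> card (parcs H `` {v}) = d" and "2 \<le> d"
    and ndvd: "\<not> 3 dvd card (pverts H)"
    and large: "card (pverts G) * (card (pverts G) + 3) < card (pverts H)"
    and path: "\<And>u. u \<in> pverts G \<Longrightarrow> \<exists>k\<in>{2, 3, 4}. is_path k (with_proj (induced G (component G u)))"
    and uniq: "\<And>u v. u \<in> pverts G \<Longrightarrow> v \<in> pverts G \<Longrightarrow>
      is_path 4 (with_proj (induced G (component G u))) \<Longrightarrow>
      is_path 4 (with_proj (induced G (component G v))) \<Longrightarrow> component G u = component G v"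
  shows "\<exists>\<phi>. embedding \<phi> G H"
proof -
  interpret H: pair_graph H by fact
  let ?C = "component G"
  define four where "four D \<longleftrightarrow> is_path 4 (with_proj (induced G D))" for D
  define \<D> where "\<D> = {D \<in> ?C ` pverts G. \<not> four D}"
  have disj: "D \<inter> E = {}" if "D \<in> ?C ` pverts G" "E \<in> ?C ` pverts G" "D \<noteq> E" for D E
    using that component_eq by blast
  have small: "\<exists>\<phi>. embedding \<phi> (induced G D) H \<and> \<phi> ` D \<inter> S = {}"
    if D: "D \<in> \<D>" and S: "finite S" "S \<subseteq> pverts H" "card S \<le> card (pverts G)" for D S
  proof -
    \<comment> \<open>By monotonicity the single size bound \<open>large\<close> serves every stage
      of the greedy process.\<close>
    have "card S * (card S + 3) \<le> card (pverts G) * (card (pverts G) + 3)"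
      using S(3) by (intro mult_mono) auto
    then have "card S * (card S + 3) < card (pverts H)" using large by linarith
    then obtain \<psi> where \<psi>: "embedding \<psi> (path_graph 3) H" "\<psi> ` {..<3} \<inter> S = {}"
      using H.ex_P3_avoiding[OF reg \<open>2 \<le> d\<close> S(1,2)] by blast
    obtain u where u: "u \<in> pverts G" "D = ?C u" "\<not> four D" using D by (auto simp: \<D>_def)
    obtain k where k: "k \<le> 3" "is_path k (with_proj (induced G D))"
    proof -
      obtain k where "k \<in> {2, 3, 4}" "is_path k (with_proj (induced G D))"
        using path[OF u(1)] u(2) by blast
      then show thesis using that[of k] u(3) by (auto simp: four_def)
    qed
    obtain \<phi> where \<phi>: "embedding \<phi> (induced G D) (path_graph k)"
      using is_pathD[OF k(2) pair_wf_digraph_induced] by blast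
    have "embedding (\<psi> \<circ> \<phi>) (induced G D) H"
      using \<phi> embedding_path_graph_mono[OF k(1) \<psi>(1)] by (rule embedding_trans)
    moreover have "\<phi> ` D \<subseteq> {..<3}" using \<phi> k(1) by (auto simp: embedding_def)
    then have "(\<psi> \<circ> \<phi>) ` D \<inter> S = {}" using \<psi>(2) by auto
    ultimately show ?thesis by blast
  qed
  \<comment> \<open>If no component is a \<open>P\<^sub>4\<close>, the empty set stands in for
    \<open>D0\<close>, and any map embeds it.\<close>
  obtain D0 \<phi>0 where D0: "embedding \<phi>0 (induced G D0) H"
    "D0 = {} \<and> (\<forall>u\<in>pverts G. \<not> four (?C u)) \<or> D0 \<in> ?C ` pverts G \<and> four D0"
  proof (cases "\<exists>u\<in>pverts G. four (?C u)")
    case True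
    then obtain u where u: "u \<in> pverts G" "four (?C u)" by blast
    obtain \<phi> where \<phi>: "embedding \<phi> (induced G (?C u)) (path_graph 4)"
      using is_pathD[OF u(2)[unfolded four_def] pair_wf_digraph_induced] by blast
    obtain \<psi> where "embedding \<psi> (path_graph 4) H"
      using H.ex_P4[OF reg \<open>2 \<le> d\<close> ndvd] by blast
    with \<phi> have "embedding (\<psi> \<circ> \<phi>) (induced G (?C u)) H" by (rule embedding_trans)
    then show thesis using u that by blast
  next
    case False
    then show thesis using that[of undefined "{}"] by (auto simp: embedding_def)
  qed
  have cover: "?C u \<in> insert D0 \<D>" if "u \<in> pverts G" for u
    using that D0(2) uniq by (auto simp: \<D>_def four_def)
  have U: "\<Union>(insert D0 \<D>) = pverts G"
  proof
    show "\<Union>(insert D0 \<D>) \<subseteq> pverts G"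
      using D0(2) component_subset by (auto simp: \<D>_def)
    show "pverts G \<subseteq> \<Union>(insert D0 \<D>)"
      using cover component_refl by fastforce
  qed
  have "\<exists>\<phi>. inj_on \<phi> (\<Union>(insert D0 \<D>)) \<and> \<phi> ` \<Union>(insert D0 \<D>) \<subseteq> pverts H \<and>
    (\<forall>D\<in>insert D0 \<D>. embedding \<phi> (induced G D) H)"
  proof (rule embedding_family[OF _ D0(1) small])
    show "finite \<D>" using pair_finite_verts by (simp add: \<D>_def)
    show "D \<subseteq> pverts G" if "D \<in> insert D0 \<D>" for D using that U by blast
    show "D \<inter> E = {}" if "D \<in> insert D0 \<D>" "E \<in> insert D0 \<D>" "D \<noteq> E" for D E
      using that D0(2) disj[of D E] by (auto simp: \<D>_def)
  qed (assumption | rule pair_finite_verts)+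
  then obtain \<phi> where \<phi>: "inj_on \<phi> (pverts G)" "\<phi> ` pverts G \<subseteq> pverts H"
    "\<And>D. D \<in> insert D0 \<D> \<Longrightarrow> embedding \<phi> (induced G D) H" unfolding U by blast
  \<comment> \<open>Every arc lies inside one component, so embedding the components separately
    preserves all arcs.\<close>
  have "(\<phi> u, \<phi> v) \<in> parcs H" if uv: "(u, v) \<in> parcs G" for u v
  proof -
    have "?C u \<in> insert D0 \<D>" using uv cover by (blast dest: wellformed')
    then have "embedding \<phi> (induced G (?C u)) H" by (rule \<phi>(3))
    moreover have "u \<in> ?C u" "v \<in> ?C u" using component_refl component_closed uv by fast+
    ultimately show ?thesis using uv by (simp add: embedding_def)
  qed
  then have "embedding \<phi> G H" using \<phi>(1,2) by (simp add: embedding_def)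
  then show ?thesis by blast
qed

section \<open>The characterization\<close>

theorem proposition1p4:
  fixes F :: "'a pair_pre_digraph"
  assumes "pair_graph F"
    and "pverts F \<noteq> {}"
    and "no_isolated_verts F"
  shows "infinite {n. rex n F = 0} \<longleftrightarrow>
    (\<forall>C \<in> components F. is_path 2 C \<or> is_path 3 C \<or> is_path 4 C) \<and>
    (\<forall>C \<in> components F. \<forall>D \<in> components F. is_path 4 C \<and> is_path 4 D \<longrightarrow> C = D)"
    (is "_ \<longleftrightarrow> ?short \<and> ?unique")
proof -
  interpret F: pair_graph F by fact
  let ?C = "component F" and ?N = "card (pverts F)"
  let ?P = "\<lambda>u. with_proj (induced F (?C u))"
  \<comment> \<open>This excludes components with a single vertex and gives \<open>F\<close> an
    edge.\<close>
  have nbr: "\<exists>v. (u, v) \<in> parcs F" if "u \<in> pverts F" for u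
  proof -
    have "card (parcs F `` {u}) \<noteq> 0"
      using that assms(3) by (simp add: no_isolated_verts_def out_degree_with_proj)
    then have "parcs F `` {u} \<noteq> {}" by (metis card.empty)
    then show ?thesis by blast
  qed
  have card4: "card (?C u) = 4" if "is_path 4 (?P u)" for u
    using is_pathD[OF that pair_wf_digraph_induced] by simp
  have eq: "?C u = ?C v" if "?P u = ?P v" for u v
    using arg_cong[OF that, of verts] by simp
  show ?thesis
  proof
    assume inf: "infinite {n. rex n F = 0}"
    have zero: "\<exists>n > m. rex n F = 0" for m
      using inf by (auto simp: infinite_nat_iff_unbounded)
    have "is_path 2 (?P u) \<or> is_path 3 (?P u) \<or> is_path 4 (?P u)" if u: "u \<in> pverts F" for u
    proof -
      \<comment> \<open>Large enough both for the triangles and 4-cycles and for a single cycle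
        longer than \<open>F\<close> has vertices, so each construction would contradict
        \<open>rex n F = 0\<close>.\<close>
      obtain n where n: "n > ?N + 8" "rex n F = 0" using zero by blast
      have fin: "finite (?C u)"
        using F.component_subset[OF u] F.pair_finite_verts by (rule finite_subset)
      have "card (?C u) < 5"
        using F.rex_nonzero_large_component[OF u, of n] n by (cases "card (?C u) < 5") auto
      moreover have path: "is_path (card (?C u)) (?P u)"
        using F.rex_nonzero_not_path[OF u, of n] n by auto
      moreover have "2 \<le> card (?C u)"
      proof -
        obtain v where v: "(u, v) \<in> parcs F" using nbr u by blast
        have "{u, v} \<subseteq> ?C u" using component_refl component_closed[OF v] by fast
        then have "card {u, v} \<le> card (?C u)" using fin by (rule card_mono[rotated])
        then show ?thesis using F.no_loops'[OF v] by simp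
      qed
      ultimately consider "card (?C u) = 2" | "card (?C u) = 3" | "card (?C u) = 4" by linarith
      then show ?thesis using path by cases auto
    qed
    moreover have "?P u = ?P v"
      if uv: "u \<in> pverts F" "v \<in> pverts F" and "is_path 4 (?P u)" "is_path 4 (?P v)" for u v
    proof -
      have c: "card (?C u) = 4" "card (?C v) = 4" using card4 that by blast+
      obtain n where n: "n > 3" "rex n F = 0" using zero by blast
      \<comment> \<open>Disjoint components would make \<open>rex n F\<close> nonzero; components
        that meet coincide.\<close>
      have "?C u \<inter> ?C v \<noteq> {}" using F.rex_nonzero_two_P4[OF uv c, of n] n by auto
      then have "?C u = ?C v" using F.component_eq by blast
      then show ?thesis by simp
    qed
    ultimately show "?short \<and> ?unique"
      by (auto simp: F.components_conv_component)
  next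
    assume rhs: "?short \<and> ?unique"
    have path: "\<exists>k\<in>{2, 3, 4}. is_path k (?P u)" if "u \<in> pverts F" for u
      using rhs that by (auto simp: F.components_conv_component)
    have uniq: "?C u = ?C v" if "u \<in> pverts F" "v \<in> pverts F" "is_path 4 (?P u)" "is_path 4 (?P v)"
      for u v
      using rhs that by (intro eq) (simp add: F.components_conv_component)
    \<comment> \<open>Being 1 modulo 6, \<open>n\<close> is odd, which forces even degree, and not
      divisible by 3, as \<open>ex_P4\<close> requires. The product supplies the size needed to
      avoid used vertices, and \<open>m\<close> makes such \<open>n\<close> arbitrarily
      large.\<close>
    have zero: "rex n F = 0" if n: "n = 6 * (m + ?N * (?N + 3)) + 1" for n m
    proof (rule rex_eq_0I)
      show "parcs F \<noteq> {}" using nbr assms(2) by fastforce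
      fix H :: "nat pair_pre_digraph"
      assume H: "pair_graph H" "card (pverts H) = n" "regular_graph H" "parcs H \<noteq> {}"
      interpret H: pair_graph H by fact
      obtain d where reg: "\<And>v. v \<in> pverts H \<Longrightarrow> card (parcs H `` {v}) = d"
        using H(3) by (auto simp: regular_graph_def out_degree_with_proj)
      have cd: "card (parcs H) = n * d" using H.card_parcs_regular[OF reg] H(2) by simp
      have "odd n" using n by simp
      then have "even d" using even_card_parcs[OF H(1)] cd by simp
      moreover have "d \<noteq> 0" using cd H(4) H.pair_finite_arcs by auto
      ultimately have "2 \<le> d" by (auto elim: evenE)
      moreover have "\<not> 3 dvd card (pverts H)" unfolding H(2) n by presburger
      moreover have "?N * (?N + 3) < card (pverts H)" 
      proof -
        \<comment> \<open>Replacing the product by a variable \<open>x\<close> makes the inequality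
          linear.\<close>
        have "x < 6 * (m + x) + 1" for x :: nat by simp
        then show ?thesis unfolding H(2) n .
      qed
      ultimately have "\<exists>\<phi>. embedding \<phi> F H"
        using F.embedding_of_small_paths[OF H(1) reg] path uniq by blast
      then show "contains_copy H F"
        by (simp add: contains_copy_iff_embedding F.pair_wf_digraph_axioms H.pair_wf_digraph_axioms)
    qed (rule F.pair_wf_digraph_axioms)
    show "infinite {n. rex n F = 0}"
      unfolding infinite_nat_iff_unbounded
    proof
      fix m
      have "m < 6 * (m + x) + 1" for x :: nat by simp
      then show "\<exists>n > m. n \<in> {n. rex n F = 0}"
        using zero[OF refl] by blast
    qed
  qed
qed

end
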